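(* Let $(B,\Diamond)$ be a modal algebra and $\mathbb{X}=(X,\tau,R)$ its dual modal space. Then 1. $(B,\Diamond)$ is a $\sigma$-modal algebra if and only if $\mathbb{X}$ is a $\sigma$-modal space; 2. $(B,\Diamond)$ is a measurable $\sigma$-modal algebra if and only if $\mathbb{X}$ is a measurable $\sigma$-modal space.
   Context: A modal algebra is a pair $(B,\Diamond)$ of a Boolean algebra $B$ and a map $\Diamond:B\to B$ preserving finite joins (including $\Diamond\bot=\bot$). A $\sigma$-Boolean algebra is a Boolean algebra in which all countable joins and meets exist. $(B,\Diamond)$ is a $\sigma$-modal algebra if $B$ is a $\sigma$-Boolean algebra, $\Diamond\bot=\bot$, and $\Diamond\bigvee_{n\in\omega}b_n=\bigvee_{n\in\omega}\Diamond b_n$ for all sequences $(b_n)_{n\in\omega}$ in $B$. It is a measurable $\sigma$-modal algebra if moreover for every descending chain $b_0\ge b_1\ge\cdots$ in $B$, $\bigwedge_{n\in\omega}b_n=\bot$ implies $\bigwedge_{n\in\omega}\Diamond b_n=\bot$. A Stone space is a compact Hausdorff space whose clopen sets form a basis. For a relation $R$ on $X$ write $R[x]=\{y\mid xRy\}$ and $\Diamond_R S=\{x\in X\mid R[x]\cap S\neq\emptyset\}$ for $S\subseteq X$. A modal space is a triple $(X,\tau,R)$ where $(X,\tau)$ is a Stone space, $R[x]$ is closed for every $x\in X$, and $\Diamond_R a$ is clopen whenever $a$ is clopen. The dual modal space of a modal algebra $(B,\Diamond)$ is $(X,\tau,R)$ where $X$ is the set of ultrafilters of $B$, $\tau$ is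 the topology generated by the sets $\{u\in X\mid b\in u\}$ for $b\in B$, and $uRv$ iff for all $b\in B$, $b\in v$ implies $\Diamond b\in u$. A $\sigma$-Stone space is a Stone space in which the closure $\overline{\bigcup_{n\in\omega}a_n}$ is clopen for every sequence $(a_n)_{n\in\omega}$ of clopen sets. A $\sigma$-modal space is a modal space $(X,\tau,R)$ such that $(X,\tau)$ is a $\sigma$-Stone space and for every sequence $(a_n)_{n\in\omega}$ of clopen sets, $\Diamond_R\big(\overline{\bigcup_{n\in\omega}a_n}\big)=\overline{\Diamond_R\big(\bigcup_{n\in\omega}a_n\big)}$. A basic null-set of a Stone space is a set of the form $\bigcap_{n\in\omega}a_n$ where $(a_n)_{n\in\omega}$ is a sequence of clopen sets with $\mathrm{int}(\bigcap_{n\in\omega}a_n)=\emptyset$. A Baire null-set is a subset that can be covered by countably many basic null-sets. A measurable $\sigma$-modal space is a $\sigma$-modal space such that for every Baire null-set $S$, the set $\Diamond_R S$ is also a Baire null-set. *)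

theory Defs
  imports "HOL-Analysis.Analysis" "HOL-Library.Lub_Glb"
begin

section \<open>Modal algebras\<close>

definition modal_algebra :: "('a::boolean_algebra \<Rightarrow> 'a) \<Rightarrow> bool" where
  "modal_algebra dia \<longleftrightarrow> dia bot = bot \<and> (\<forall>a b. dia (sup a b) = sup (dia a) (dia b))"

text \<open>Countable joins and meets exist only under hypotheses in a Boolean algebra, so they are
  expressed relationally: \<open>isLub UNIV S s\<close> says that \<open>s\<close> is the join of \<open>S\<close>, and
  \<open>isGlb UNIV S s\<close> that \<open>s\<close> is its meet.\<close>

definition sigma_boolean_algebra :: "'a::boolean_algebra itself \<Rightarrow> bool" where
  "sigma_boolean_algebra (_ :: 'a itself) \<longleftrightarrow>
    (\<forall>S :: 'a set. countable S \<longrightarrow> (\<exists>s. isLub UNIV S s) \<and> (\<exists>s. isGlb UNIV S s))"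

definition sigma_modal_algebra :: "('a::boolean_algebra \<Rightarrow> 'a) \<Rightarrow> bool" where
  "sigma_modal_algebra dia \<longleftrightarrow>
    sigma_boolean_algebra TYPE('a) \<and>
    dia bot = bot \<and>
    (\<forall>(b :: nat \<Rightarrow> 'a) s. isLub UNIV (range b) s \<longrightarrow> isLub UNIV (range (\<lambda>n. dia (b n))) (dia s))"

definition measurable_sigma_modal_algebra :: "('a::boolean_algebra \<Rightarrow> 'a) \<Rightarrow> bool" where
  "measurable_sigma_modal_algebra dia \<longleftrightarrow>
    sigma_modal_algebra dia \<and>
    (\<forall>b :: nat \<Rightarrow> 'a. decseq b \<and> isGlb UNIV (range b) bot
        \<longrightarrow> isGlb UNIV (range (\<lambda>n. dia (b n))) bot)"


section \<open>Modal spaces\<close>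

definition clopenin :: "'x topology \<Rightarrow> 'x set \<Rightarrow> bool" where
  "clopenin T a \<longleftrightarrow> openin T a \<and> closedin T a"

definition stone_space :: "'x topology \<Rightarrow> bool" where
  "stone_space T \<longleftrightarrow>
    compact_space T \<and> Hausdorff_space T \<and> openin T = arbitrary union_of (clopenin T)"

definition rel_dia :: "'x topology \<Rightarrow> ('x \<times> 'x) set \<Rightarrow> 'x set \<Rightarrow> 'x set" where
  "rel_dia T R S = {x \<in> topspace T. R `` {x} \<inter> S \<noteq> {}}"

definition modal_space :: "'x topology \<Rightarrow> ('x \<times> 'x) set \<Rightarrow> bool" where
  "modal_space T R \<longleftrightarrow>
    stone_space T \<and>
    R \<subseteq> topspace T \<times> topspace T \<and>
    (\<forall>x \<in> topspace T. closedin T (R `` {x})) \<and>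
    (\<forall>a. clopenin T a \<longrightarrow> clopenin T (rel_dia T R a))"

definition sigma_stone_space :: "'x topology \<Rightarrow> bool" where
  "sigma_stone_space T \<longleftrightarrow>
    stone_space T \<and>
    (\<forall>a :: nat \<Rightarrow> 'x set. (\<forall>n. clopenin T (a n)) \<longrightarrow> clopenin T (T closure_of (\<Union>n. a n)))"

definition sigma_modal_space :: "'x topology \<Rightarrow> ('x \<times> 'x) set \<Rightarrow> bool" where
  "sigma_modal_space T R \<longleftrightarrow>
    modal_space T R \<and>
    sigma_stone_space T \<and>
    (\<forall>a :: nat \<Rightarrow> 'x set. (\<forall>n. clopenin T (a n)) \<longrightarrow>
        rel_dia T R (T closure_of (\<Union>n. a n)) = T closure_of (rel_dia T R (\<Union>n. a n)))"

definition basic_null_set :: "'x topology \<Rightarrow> 'x set \<Rightarrow> bool" where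
  "basic_null_set T N \<longleftrightarrow>
    (\<exists>a :: nat \<Rightarrow> 'x set. (\<forall>n. clopenin T (a n)) \<and> N = (\<Inter>n. a n) \<and>
        T interior_of (\<Inter>n. a n) = {})"

definition baire_null_set :: "'x topology \<Rightarrow> 'x set \<Rightarrow> bool" where
  "baire_null_set T S \<longleftrightarrow>
    S \<subseteq> topspace T \<and>
    (\<exists>\<N>. countable \<N> \<and> (\<forall>N \<in> \<N>. basic_null_set T N) \<and> S \<subseteq> \<Union>\<N>)"

definition measurable_sigma_modal_space :: "'x topology \<Rightarrow> ('x \<times> 'x) set \<Rightarrow> bool" where
  "measurable_sigma_modal_space T R \<longleftrightarrow>
    sigma_modal_space T R \<and>
    (\<forall>S. baire_null_set T S \<longrightarrow> baire_null_set T (rel_dia T R S))"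


section \<open>The dual modal space\<close>

definition proper_filter :: "'a::boolean_algebra set \<Rightarrow> bool" where
  "proper_filter F \<longleftrightarrow>
    top \<in> F \<and> bot \<notin> F \<and>
    (\<forall>a \<in> F. \<forall>b \<in> F. inf a b \<in> F) \<and>
    (\<forall>a \<in> F. \<forall>b. a \<le> b \<longrightarrow> b \<in> F)"

definition ultrafilters :: "'a::boolean_algebra set set" where
  "ultrafilters = {u. proper_filter u \<and> (\<forall>F. proper_filter F \<and> u \<subseteq> F \<longrightarrow> F = u)}"

text \<open>The generating sets cover \<^const>\<open>ultrafilters\<close> (take \<open>b = top\<close>), so this is
  the underlying set of the generated topology.\<close>

definition dual_topology :: "'a::boolean_algebra set topology" where
  "dual_topology = topology_generated_by (range (\<lambda>b. {u \<in> ultrafilters. b \<in> u}))"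

definition dual_rel :: "('a::boolean_algebra \<Rightarrow> 'a) \<Rightarrow> ('a set \<times> 'a set) set" where
  "dual_rel dia =
    {(u, v). u \<in> ultrafilters \<and> v \<in> ultrafilters \<and> (\<forall>b. b \<in> v \<longrightarrow> dia b \<in> u)}"

end

theory Submission
  imports Defs
begin

text \<open>
  Under Stone duality an element \<open>b\<close> becomes the clopen set \<open>stone b\<close> of the ultrafilters containing
  it, and every clopen set of the dual space arises in this way. The theorem holds because each
  algebraic condition is the translation of a topological one along this correspondence:

  \<^item> \<open>s\<close> is the join of the \<open>b\<^sub>n\<close> iff \<open>stone s\<close> is the closure of the union of the sets \<open>stone b\<^sub>n\<close>
    (\<open>closure_of_UN_stone_eq_iff\<close>);
  \<^item> \<open>bot\<close> is the meet of the \<open>b\<^sub>n\<close> iff the intersection of the sets \<open>stone b\<^sub>n\<close> has empty interior, so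
    that it is a basic null-set (\<open>interior_of_INT_stone_empty_iff\<close>);
  \<^item> the diamond of the dual relation maps \<open>stone b\<close> to \<open>stone (dia b)\<close>, and commutes with
    intersections of descending chains of such sets (\<open>rel_dia_INT_stone\<close>).

  As the diamond of a relation always commutes with unions, the first and third facts turn
  preservation of countable joins by \<open>dia\<close> into the defining equation of sigma-modal spaces.

  For measurability, the second and third facts translate the algebraic condition into the statement
  that the diamond maps basic null-sets to basic null-sets. This implies that Baire null-sets go to
  Baire null-sets, again since unions are preserved. The converse needs more: the image of a
  basic null-set is only known to be covered by countably many basic null-sets. These are closed and
  nowhere dense, and in a compact Hausdorff space the Baire category theorem says that what they
  cover has empty interior (\<open>interior_of_baire_null_set\<close>), which is what the meet condition demands.
\<close>


section \<open>Ultrafilters\<close>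

lemma ultrafilter_mem:
  assumes "u \<in> ultrafilters"
  shows ultrafilter_top: "top \<in> u" and ultrafilter_bot: "bot \<notin> u"
    and ultrafilter_up: "a \<in> u \<Longrightarrow> a \<le> b \<Longrightarrow> b \<in> u"
    and ultrafilter_inf: "a \<in> u \<Longrightarrow> b \<in> u \<Longrightarrow> inf a b \<in> u"
  using assms by (auto simp: ultrafilters_def proper_filter_def)

lemma ultrafilter_inf_iff:
  "u \<in> ultrafilters \<Longrightarrow> inf a b \<in> u \<longleftrightarrow> a \<in> u \<and> b \<in> u"
  by (meson inf.cobounded1 inf.cobounded2 ultrafilter_inf ultrafilter_up)

text \<open>If \<open>- b \<notin> u\<close>, then no element of \<open>u\<close> is disjoint from \<open>b\<close>, so \<open>u\<close> and \<open>b\<close> generate a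
  proper filter; maximality puts \<open>b\<close> into \<open>u\<close>.\<close>

lemma ultrafilter_compl_iff:
  assumes u: "u \<in> ultrafilters"
  shows "- b \<in> u \<longleftrightarrow> b \<notin> u"
proof
  show "b \<notin> u" if "- b \<in> u"
    using ultrafilter_inf[OF u that, of b] ultrafilter_bot[OF u] by auto
next
  assume "b \<notin> u"
  show "- b \<in> u"
  proof (rule ccontr)
    assume nb: "- b \<notin> u"
    define F where "F = {d. \<exists>a\<in>u. inf a b \<le> d}"
    have "proper_filter F"
      unfolding proper_filter_def
    proof (intro conjI ballI allI impI)
      show "top \<in> F"
        using ultrafilter_top[OF u] by (auto simp: F_def)
      show "bot \<notin> F"
      proof
        assume "bot \<in> F"
        then obtain a where "a \<in> u" "inf a b \<le> bot"
          by (auto simp: F_def)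
        then have "a \<le> - b"
          by (simp add: inf_shunt bot_unique)
        then show False
          using nb ultrafilter_up[OF u \<open>a \<in> u\<close>] by blast
      qed
    next
      fix d e assume "d \<in> F" "e \<in> F"
      then obtain a c where ac: "a \<in> u" "c \<in> u" "inf a b \<le> d" "inf c b \<le> e"
        by (auto simp: F_def)
      have "inf (inf a c) b \<le> inf a b" "inf (inf a c) b \<le> inf c b"
        by (simp_all add: le_infI1)
      then have "inf (inf a c) b \<le> inf d e"
        using ac(3,4) by (meson le_infI order.trans)
      then show "inf d e \<in> F"
        using ultrafilter_inf[OF u ac(1,2)] by (auto simp: F_def)
    next
      fix d e assume "d \<in> F" "d \<le> e"
      then show "e \<in> F"
        by (auto simp: F_def intro: order.trans)
    qed
    moreover have "u \<subseteq> F"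
      unfolding F_def using inf.cobounded1 by blast
    ultimately have "F = u"
      using u by (auto simp: ultrafilters_def)
    moreover have "b \<in> F"
      using ultrafilter_top[OF u] by (auto simp: F_def)
    ultimately show False
      using \<open>b \<notin> u\<close> by blast
  qed
qed

lemma ultrafilter_sup_iff:
  assumes u: "u \<in> ultrafilters"
  shows "sup a b \<in> u \<longleftrightarrow> a \<in> u \<or> b \<in> u"
  using ultrafilter_compl_iff[OF u] ultrafilter_inf_iff[OF u]
  by (metis compl_sup)

lemma ultrafilters_eqI:
  assumes "u \<in> ultrafilters" "v \<in> ultrafilters" "u \<subseteq> v"
  shows "u = v"
  using assms unfolding ultrafilters_def by blast

lemma proper_filter_extends:
  assumes "proper_filter F"
  obtains u where "u \<in> ultrafilters" "F \<subseteq> u"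
proof -
  let ?A = "{G. proper_filter G \<and> F \<subseteq> G}"
  have "\<exists>M\<in>?A. \<forall>G\<in>?A. M \<subseteq> G \<longrightarrow> G = M"
  proof (rule subset_Zorn_nonempty)
    show "?A \<noteq> {}"
      using assms by auto
  next
    fix C assume C: "C \<noteq> {}" "subset.chain ?A C"
    have CA: "\<And>G. G \<in> C \<Longrightarrow> proper_filter G \<and> F \<subseteq> G"
      using C(2) by (auto simp: subset.chain_def)
    have "proper_filter (\<Union>C)"
      unfolding proper_filter_def
    proof (intro conjI ballI allI impI)
      show "top \<in> \<Union>C" "bot \<notin> \<Union>C"
        using CA C(1) by (auto simp: proper_filter_def)
    next
      fix a b assume "a \<in> \<Union>C" "b \<in> \<Union>C"
      then obtain G H where GH: "G \<in> C" "H \<in> C" "a \<in> G" "b \<in> H"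
        by blast
      then have "G \<subseteq> H \<or> H \<subseteq> G"
        using C(2) by (auto simp: subset_chain_def)
      then obtain K where "K \<in> C" "a \<in> K" "b \<in> K"
        using GH by blast
      then show "inf a b \<in> \<Union>C"
        using CA unfolding proper_filter_def by blast
    next
      fix a b assume "a \<in> \<Union>C" "a \<le> b"
      then show "b \<in> \<Union>C"
        using CA by (auto simp: proper_filter_def)
    qed
    then show "\<Union>C \<in> ?A"
      using CA C(1) by blast
  qed
  then obtain M where M: "M \<in> ?A" and max: "\<forall>G\<in>?A. M \<subseteq> G \<longrightarrow> G = M"
    by (rule bexE)
  have "G = M" if "proper_filter G" "M \<subseteq> G" for G
    using max M that by auto
  then have "M \<in> ultrafilters"
    using M unfolding ultrafilters_def by auto
  then show thesis
    using that M by auto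
qed

text \<open>The ideal \<open>I\<close> and the filter base \<open>G\<close> generate the filter of all \<open>d\<close> with
  \<^term>\<open>g \<le> sup d c\<close> for some \<open>g \<in> G\<close> and \<open>c \<in> I\<close>; it is proper precisely because \<open>G\<close> misses the downward closed set \<open>I\<close>, and it contains the
  complements of the elements of \<open>I\<close>. Separation of elements, compactness of the dual space and
  the existence of \<open>R\<close>-successors are all instances.\<close>

lemma ultrafilter_avoiding_ideal:
  fixes G I :: "'a::boolean_algebra set"
  assumes ne: "G \<noteq> {}"
    and dir: "\<And>a b. a \<in> G \<Longrightarrow> b \<in> G \<Longrightarrow> \<exists>g\<in>G. g \<le> a \<and> g \<le> b"
    and bot: "bot \<in> I"
    and sup: "\<And>a b. a \<in> I \<Longrightarrow> b \<in> I \<Longrightarrow> sup a b \<in> I"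
    and down: "\<And>a b. a \<in> I \<Longrightarrow> b \<le> a \<Longrightarrow> b \<in> I"
    and disj: "G \<inter> I = {}"
  obtains u where "u \<in> ultrafilters" "G \<subseteq> u" "u \<inter> I = {}"
proof -
  define F where "F = {d. \<exists>g\<in>G. \<exists>c\<in>I. g \<le> sup d c}"
  have "proper_filter F"
    unfolding proper_filter_def
  proof (intro conjI ballI allI impI)
    show "top \<in> F"
      using ne bot by (auto simp: F_def)
    show "bot \<notin> F"
      using disj down by (auto simp: F_def)
  next
    fix d e assume "d \<in> F" "e \<in> F"
    then obtain g h c c' where gh: "g \<in> G" "h \<in> G" "c \<in> I" "c' \<in> I" "g \<le> sup d c" "h \<le> sup e c'"
      by (auto simp: F_def)
    obtain k where k: "k \<in> G" "k \<le> g" "k \<le> h"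
      using dir gh by blast
    have "k \<le> sup d (sup c c')" "k \<le> sup e (sup c c')"
      using gh k by (meson le_supI1 le_supI2 order.trans sup.cobounded1 sup.cobounded2 sup.mono order_refl)+
    then have "k \<le> sup (inf d e) (sup c c')"
      by (simp add: sup_inf_distrib2)
    then show "inf d e \<in> F"
      using k(1) sup[OF gh(3,4)] by (auto simp: F_def)
  next
    fix d e assume "d \<in> F" "d \<le> e"
    then show "e \<in> F"
      unfolding F_def by (blast intro: order.trans sup.mono order_refl)
  qed
  then obtain u where u: "u \<in> ultrafilters" "F \<subseteq> u"
    by (rule proper_filter_extends)
  have "G \<subseteq> F"
    using bot by (auto simp: F_def)
  moreover have "- c \<in> F" if "c \<in> I" for c
    using that ne by (force simp: F_def)
  then have "u \<inter> I = {}"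
    using u ultrafilter_compl_iff[OF u(1)] by blast
  ultimately show thesis
    using that u by blast
qed


section \<open>The dual space\<close>

definition stone :: "'a::boolean_algebra \<Rightarrow> 'a set set" where
  "stone b = {u \<in> ultrafilters. b \<in> u}"

lemma stone_top [simp]: "stone top = ultrafilters"
  and stone_bot [simp]: "stone bot = {}"
  and stone_inf: "stone (inf a b) = stone a \<inter> stone b"
  and stone_sup: "stone (sup a b) = stone a \<union> stone b"
  and stone_compl: "stone (- a) = ultrafilters - stone a"
  by (auto simp: stone_def ultrafilter_top ultrafilter_bot ultrafilter_inf_iff
      ultrafilter_sup_iff ultrafilter_compl_iff)

lemma stone_subset_ultrafilters: "stone b \<subseteq> ultrafilters"
  by (auto simp: stone_def)

lemma stone_subset_iff [simp]: "stone a \<subseteq> stone b \<longleftrightarrow> a \<le> b"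
proof
  assume sub: "stone a \<subseteq> stone b"
  show "a \<le> b"
  proof (rule ccontr)
    assume "\<not> a \<le> b"
    then obtain u where "u \<in> ultrafilters" "{a} \<subseteq> u" "u \<inter> {c. c \<le> b} = {}"
      by (rule_tac ultrafilter_avoiding_ideal[of "{a}" "{c. c \<le> b}"]) (auto intro: order.trans)
    then show False
      using sub by (auto simp: stone_def)
  qed
next
  show "stone a \<subseteq> stone b" if "a \<le> b"
    using that by (auto simp: stone_def ultrafilter_up)
qed

lemma stone_eq_iff [simp]: "stone a = stone b \<longleftrightarrow> a = b"
  by (metis order.antisym order_refl stone_subset_iff)

lemma stone_eq_empty_iff [simp]: "stone a = {} \<longleftrightarrow> a = bot"
  using stone_eq_iff[of a bot] by simp

lemma topspace_dual [simp]: "topspace dual_topology = ultrafilters"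
  using stone_top stone_subset_ultrafilters
  by (fastforce simp: dual_topology_def stone_def)

lemma openin_stone: "openin dual_topology (stone b)"
  unfolding dual_topology_def stone_def by (rule topology_generated_by_Basis) simp

lemma clopenin_stone: "clopenin dual_topology (stone b)"
proof -
  have "topspace dual_topology - stone b = stone (- b)"
    by (simp add: stone_compl)
  then show ?thesis
    using openin_stone stone_subset_ultrafilters
    by (metis clopenin_def closedin_def topspace_dual)
qed

lemma closedin_stone: "closedin dual_topology (stone b)"
  using clopenin_stone by (auto simp: clopenin_def)

text \<open>The sets \<^term>\<open>stone b\<close> are closed under finite intersections, so the generating
  family is already a base.\<close>

lemma openin_dual_imp_stone_base:
  assumes "openin dual_topology U" "u \<in> U"
  obtains b where "u \<in> stone b" "stone b \<subseteq> U"
proof -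
  have "generate_topology_on (range stone) U"
    using assms(1) unfolding dual_topology_def stone_def[abs_def]
    by (rule openin_topology_generated_by)
  then have "\<forall>u\<in>U. \<exists>b. u \<in> stone b \<and> stone b \<subseteq> U"
  proof induction
    case (Int U V)
    then show ?case
      by (metis Int_iff Int_mono stone_inf)
  next
    case (UN K)
    then show ?case
      by (meson UnionE Union_upper subset_trans)
  qed auto
  then show thesis
    using assms(2) that by blast
qed

text \<open>Given a cover of the dual space, the elements \<open>d\<close> for which \<^term>\<open>stone d\<close> has a finite
  subcover form an ideal. Were it proper, an ultrafilter avoiding it would lie in no member of
  the cover; so it contains \<open>top\<close>.\<close>

lemma compact_space_dual: "compact_space (dual_topology :: 'a::boolean_algebra set topology)"
  unfolding compact_space_alt topspace_dual
proof (intro allI impI, elim conjE, rule ccontr)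
  fix \<U> :: "'a set set set"
  assume op: "\<forall>U\<in>\<U>. openin dual_topology U" and cov: "ultrafilters \<subseteq> \<Union>\<U>"
    and no: "\<not> (\<exists>\<F>. finite \<F> \<and> \<F> \<subseteq> \<U> \<and> ultrafilters \<subseteq> \<Union>\<F>)"
  define I where "I = {d. \<exists>\<F>. finite \<F> \<and> \<F> \<subseteq> \<U> \<and> stone d \<subseteq> \<Union>\<F>}"
  obtain u where u: "u \<in> ultrafilters" "{top} \<subseteq> u" "u \<inter> I = {}"
  proof (rule ultrafilter_avoiding_ideal[of "{top}" I])
    show "bot \<in> I"
      by (auto simp: I_def)
    show "sup a b \<in> I" if ab: "a \<in> I" "b \<in> I" for a b
    proof -
      obtain F F' where "finite F" "F \<subseteq> \<U>" "stone a \<subseteq> \<Union>F"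
        "finite F'" "F' \<subseteq> \<U>" "stone b \<subseteq> \<Union>F'"
        using ab unfolding I_def by blast
      then have "finite (F \<union> F') \<and> F \<union> F' \<subseteq> \<U> \<and> stone (sup a b) \<subseteq> \<Union>(F \<union> F')"
        by (auto simp: stone_sup)
      then show ?thesis
        unfolding I_def by blast
    qed
    show "b \<in> I" if "a \<in> I" "b \<le> a" for a b
      using that stone_subset_iff[of b a] unfolding I_def by blast
    show "{top} \<inter> I = {}"
      using no by (auto simp: I_def)
  qed auto
  obtain U where U: "U \<in> \<U>" "u \<in> U"
    using cov u(1) by blast
  then obtain b where b: "u \<in> stone b" "stone b \<subseteq> U"
    using op openin_dual_imp_stone_base by blast
  have "b \<in> I"
    using U(1) b(2) by (auto simp: I_def intro!: exI[of _ "{U}"])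
  then show False
    using u(3) b(1) by (auto simp: stone_def)
qed

lemma Hausdorff_space_dual: "Hausdorff_space dual_topology"
  unfolding Hausdorff_space_def topspace_dual
proof (intro allI impI, elim conjE)
  fix u v :: "'a set"
  assume uv: "u \<in> ultrafilters" "v \<in> ultrafilters" "u \<noteq> v"
  then obtain b where "b \<in> u" "b \<notin> v"
    using ultrafilters_eqI by blast
  then have "u \<in> stone b" "v \<in> stone (- b)" "disjnt (stone b) (stone (- b))"
    using uv by (auto simp: stone_compl disjnt_def) (auto simp: stone_def)
  then show "\<exists>U V. openin dual_topology U \<and> openin dual_topology V \<and> u \<in> U \<and> v \<in> V \<and> disjnt U V"
    using openin_stone by blast
qed

lemma stone_space_dual: "stone_space dual_topology"
  unfolding stone_space_def
proof (intro conjI compact_space_dual Hausdorff_space_dual)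
  show "openin dual_topology = arbitrary union_of (clopenin dual_topology)"
    unfolding openin_topology_base_unique
    by (metis clopenin_def clopenin_stone openin_dual_imp_stone_base)
qed

lemma finite_Union_stone:
  assumes "finite \<F>" "\<F> \<subseteq> range stone"
  shows "\<Union>\<F> \<in> range stone"
  using assms
proof induction
  case empty
  then show ?case
    using stone_bot by (metis Union_empty rangeI)
next
  case (insert U \<F>)
  then obtain a b where "U = stone a" "\<Union>\<F> = stone b"
    by auto
  then show ?case
    using stone_sup by (metis Union_insert rangeI)
qed

lemma clopenin_dual_iff: "clopenin dual_topology a \<longleftrightarrow> (\<exists>b. a = stone b)"
proof
  assume a: "clopenin dual_topology a"
  have "compactin dual_topology a"
    using a by (simp add: clopenin_def closedin_compact_space compact_space_dual)
  moreover have "a \<subseteq> \<Union>{stone b |b. stone b \<subseteq> a}"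
  proof
    fix u assume "u \<in> a"
    then obtain b where "u \<in> stone b" "stone b \<subseteq> a"
      using a openin_dual_imp_stone_base[of a u] by (auto simp: clopenin_def)
    then show "u \<in> \<Union>{stone b |b. stone b \<subseteq> a}"
      by blast
  qed
  ultimately obtain \<F> where \<F>: "finite \<F>" "\<F> \<subseteq> {stone b |b. stone b \<subseteq> a}" "a \<subseteq> \<Union>\<F>"
    using compactinD[of dual_topology a "{stone b |b. stone b \<subseteq> a}"] openin_stone by blast
  then have "a = \<Union>\<F>"
    by blast
  moreover have "\<F> \<subseteq> range stone"
    using \<F>(2) by blast
  ultimately show "\<exists>b. a = stone b"
    using finite_Union_stone[OF \<F>(1)] by blast
qed (auto simp: clopenin_stone)

lemma clopenin_dual_seqE:
  assumes "\<forall>n::nat. clopenin dual_topology (a n)"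
  obtains b where "a = (\<lambda>n. stone (b n))"
  using assms unfolding clopenin_dual_iff by metis

lemma all_clopenin_dual_seq_iff:
  "(\<forall>a :: nat \<Rightarrow> 'a::boolean_algebra set set. (\<forall>n. clopenin dual_topology (a n)) \<longrightarrow> P a) \<longleftrightarrow>
    (\<forall>b. P (\<lambda>n. stone (b n)))"
proof
  assume P: "\<forall>a. (\<forall>n. clopenin dual_topology (a n)) \<longrightarrow> P a"
  show "\<forall>b. P (\<lambda>n. stone (b n))"
    using P[rule_format, OF clopenin_stone] by (rule allI)
next
  assume "\<forall>b. P (\<lambda>n. stone (b n))"
  then show "\<forall>a. (\<forall>n. clopenin dual_topology (a n)) \<longrightarrow> P a"
    by (auto elim!: clopenin_dual_seqE)
qed


section \<open>The dual relation\<close>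

lemma modal_algebra_mono:
  assumes "modal_algebra dia" "a \<le> b"
  shows "dia a \<le> dia b"
  using assms unfolding modal_algebra_def by (metis le_iff_sup)

text \<open>For \<open>u\<close> in the right-hand side, the elements \<open>c\<close> with \<^term>\<open>dia c \<notin> u\<close> form an ideal which
  misses every \<^term>\<open>b n\<close>, and an ultrafilter containing all \<^term>\<open>b n\<close> and avoiding this ideal is a
  successor of \<open>u\<close>. The chain has to be descending for its terms to form a filter base.\<close>

lemma rel_dia_INT_stone:
  assumes dia: "modal_algebra dia" and b: "decseq b"
  shows "rel_dia dual_topology (dual_rel dia) (\<Inter>n. stone (b n)) = (\<Inter>n. stone (dia (b n)))"
proof
  show "rel_dia dual_topology (dual_rel dia) (\<Inter>n. stone (b n)) \<subseteq> (\<Inter>n. stone (dia (b n)))"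
    by (auto simp: rel_dia_def dual_rel_def stone_def)
next
  show "(\<Inter>n. stone (dia (b n))) \<subseteq> rel_dia dual_topology (dual_rel dia) (\<Inter>n. stone (b n))"
  proof
    fix u assume u: "u \<in> (\<Inter>n. stone (dia (b n)))"
    then have uf: "u \<in> ultrafilters" and bu: "\<And>n. dia (b n) \<in> u"
      by (auto simp: stone_def)
    obtain v where v: "v \<in> ultrafilters" "range b \<subseteq> v" "v \<inter> {c. dia c \<notin> u} = {}"
    proof (rule ultrafilter_avoiding_ideal[of "range b" "{c. dia c \<notin> u}"])
      show "\<exists>g\<in>range b. g \<le> x \<and> g \<le> y" if xy: "x \<in> range b" "y \<in> range b" for x y
      proof -
        obtain m n where "x = b m" "y = b n"
          using xy by blast
        then have "b (max m n) \<le> x" "b (max m n) \<le> y"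
          using decseqD[OF b] by simp_all
        then show ?thesis
          by blast
      qed
      show "bot \<in> {c. dia c \<notin> u}"
        using dia ultrafilter_bot[OF uf] by (simp add: modal_algebra_def)
      show "sup x y \<in> {c. dia c \<notin> u}" if "x \<in> {c. dia c \<notin> u}" "y \<in> {c. dia c \<notin> u}" for x y
        using that dia by (simp add: modal_algebra_def ultrafilter_sup_iff[OF uf])
      show "y \<in> {c. dia c \<notin> u}" if "x \<in> {c. dia c \<notin> u}" "y \<le> x" for x y
        using that modal_algebra_mono[OF dia] ultrafilter_up[OF uf] by blast
      show "range b \<inter> {c. dia c \<notin> u} = {}"
        using bu by auto
    qed auto
    then have "(u, v) \<in> dual_rel dia" "v \<in> (\<Inter>n. stone (b n))"
      using uf by (auto simp: dual_rel_def stone_def)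
    then show "u \<in> rel_dia dual_topology (dual_rel dia) (\<Inter>n. stone (b n))"
      using uf by (auto simp: rel_dia_def)
  qed
qed

corollary rel_dia_stone:
  "modal_algebra dia \<Longrightarrow> rel_dia dual_topology (dual_rel dia) (stone b) = stone (dia b)"
  using rel_dia_INT_stone[of dia "\<lambda>_. b"] by simp

lemma rel_dia_UN: "rel_dia T R (\<Union>i. a i) = (\<Union>i. rel_dia T R (a i))"
  by (auto simp: rel_dia_def)

text \<open>The successors of \<open>u\<close> are the ultrafilters avoiding the ideal \<open>{c. dia c \<notin> u}\<close>, so they form
  an intersection of clopen sets.\<close>

lemma modal_space_dual:
  fixes dia :: "'a::boolean_algebra \<Rightarrow> 'a"
  assumes dia: "modal_algebra dia"
  shows "modal_space dual_topology (dual_rel dia)"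
  unfolding modal_space_def
proof (intro conjI stone_space_dual ballI allI impI)
  show "dual_rel dia \<subseteq> topspace dual_topology \<times> topspace dual_topology"
    by (auto simp: dual_rel_def)
next
  fix u assume "u \<in> topspace (dual_topology :: 'a set topology)"
  then have u: "u \<in> ultrafilters"
    by simp
  let ?I = "{c. dia c \<notin> u}"
  have bot: "bot \<in> ?I"
    using dia ultrafilter_bot[OF u] by (simp add: modal_algebra_def)
  then have "dual_rel dia `` {u} = (\<Inter>c\<in>?I. stone (- c))"
    using u by (auto simp: dual_rel_def stone_compl) (auto simp: stone_def)
  with bot show "closedin dual_topology (dual_rel dia `` {u})"
    using closedin_stone by (auto intro!: closedin_Inter)
next
  fix a :: "'a set set" assume "clopenin dual_topology a"
  then show "clopenin dual_topology (rel_dia dual_topology (dual_rel dia) a)"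
    unfolding clopenin_dual_iff using rel_dia_stone[OF dia] by blast
qed


section \<open>Countable joins and sigma-modal spaces\<close>

lemma isLub_UNIV_iff:
  "isLub UNIV S s \<longleftrightarrow> (\<forall>x\<in>S. x \<le> s) \<and> (\<forall>t. (\<forall>x\<in>S. x \<le> t) \<longrightarrow> s \<le> t)"
  by (auto simp: isLub_def leastP_def isUb_def setle_def setge_def)

lemma isGlb_UNIV_iff:
  "isGlb UNIV S s \<longleftrightarrow> (\<forall>x\<in>S. s \<le> x) \<and> (\<forall>t. (\<forall>x\<in>S. t \<le> x) \<longrightarrow> t \<le> s)"
  by (auto simp: isGlb_def greatestP_def isLb_def setle_def setge_def)

lemma isGlb_if_isLub_uminus:
  fixes S :: "'a::boolean_algebra set"
  assumes "isLub UNIV (uminus ` S) s"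
  shows "isGlb UNIV S (- s)"
  using assms unfolding isGlb_UNIV_iff isLub_UNIV_iff
  by (auto simp: compl_le_swap1 compl_le_swap2)

lemma sigma_boolean_algebra_iff_seq:
  "sigma_boolean_algebra TYPE('a::boolean_algebra) \<longleftrightarrow>
    (\<forall>b :: nat \<Rightarrow> 'a. \<exists>s. isLub UNIV (range b) s)"
proof
  assume "sigma_boolean_algebra TYPE('a)"
  then show "\<forall>b :: nat \<Rightarrow> 'a. \<exists>s. isLub UNIV (range b) s"
    by (simp add: sigma_boolean_algebra_def)
next
  assume seq: "\<forall>b :: nat \<Rightarrow> 'a. \<exists>s. isLub UNIV (range b) s"
  have lub: "\<exists>s. isLub UNIV S s" if "countable S" for S :: "'a set"
  proof -
    \<comment> \<open>The empty set is not the range of a sequence; adding \<open>bot\<close> does not affect joins.\<close>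
    have "range (from_nat_into (insert bot S)) = insert bot S"
      using that by (intro range_from_nat_into) auto
    then obtain s where "isLub UNIV (insert bot S) s"
      using seq by metis
    then show ?thesis
      by (auto simp: isLub_UNIV_iff)
  qed
  show "sigma_boolean_algebra TYPE('a)"
    unfolding sigma_boolean_algebra_def
    using lub isGlb_if_isLub_uminus by (metis countable_image)
qed

text \<open>Upper bounds \<open>t\<close> of the sequence are exactly those with the union inside the closed set
  \<open>stone t\<close>, so a clopen closure gives the least one. Conversely, if \<open>s\<close> is the join and a basic
  neighbourhood \<open>stone c\<close> of a point of \<open>stone s\<close> missed the union, then \<open>- c\<close> would be an upper bound;
  hence \<open>s \<le> - c\<close>, and the point could not lie in \<open>stone c\<close>.\<close>

lemma closure_of_UN_stone_eq_iff:
  "dual_topology closure_of (\<Union>n::nat. stone (b n)) = stone s \<longleftrightarrow> isLub UNIV (range b) s"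
proof
  assume eq: "dual_topology closure_of (\<Union>n. stone (b n)) = stone s"
  show "isLub UNIV (range b) s"
    unfolding isLub_UNIV_iff
  proof (intro conjI ballI allI impI)
    fix x assume "x \<in> range b"
    then have "stone x \<subseteq> dual_topology closure_of (\<Union>n. stone (b n))"
      using closure_of_subset[of "\<Union>n. stone (b n)" dual_topology] stone_subset_ultrafilters
      by (auto simp: UN_subset_iff)
    then show "x \<le> s"
      using eq by simp
  next
    fix t assume "\<forall>x\<in>range b. x \<le> t"
    then have "dual_topology closure_of (\<Union>n. stone (b n)) \<subseteq> stone t"
      by (intro closure_of_minimal closedin_stone) (simp add: UN_subset_iff)
    then show "s \<le> t"
      using eq by simp
  qed
next
  assume s: "isLub UNIV (range b) s"
  let ?U = "\<Union>n. stone (b n)"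
  show "dual_topology closure_of ?U = stone s"
  proof
    show "dual_topology closure_of ?U \<subseteq> stone s"
      using s by (intro closure_of_minimal closedin_stone) (simp add: UN_subset_iff isLub_UNIV_iff)
  next
    show "stone s \<subseteq> dual_topology closure_of ?U"
    proof
      fix u assume us: "u \<in> stone s"
      show "u \<in> dual_topology closure_of ?U"
        unfolding in_closure_of topspace_dual
      proof (intro conjI allI impI)
        show "u \<in> ultrafilters"
          using us stone_subset_ultrafilters by blast
        fix V assume V: "u \<in> V \<and> openin dual_topology V"
        then obtain c where c: "u \<in> stone c" "stone c \<subseteq> V"
          using openin_dual_imp_stone_base by blast
        show "\<exists>y. y \<in> ?U \<and> y \<in> V"
        proof (rule ccontr)
          assume "\<not> (\<exists>y. y \<in> ?U \<and> y \<in> V)"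
          then have "stone (b n) \<subseteq> stone (- c)" for n
            using c(2) stone_subset_ultrafilters unfolding stone_compl by blast
          then have "s \<le> - c"
            using s by (simp add: isLub_UNIV_iff)
          then have "u \<in> stone (- c)"
            using us stone_subset_iff by blast
          then show False
            using c(1) by (simp add: stone_compl)
        qed
      qed
    qed
  qed
qed

lemma sigma_boolean_algebra_iff_sigma_stone_space:
  "sigma_boolean_algebra TYPE('a::boolean_algebra) \<longleftrightarrow>
    sigma_stone_space (dual_topology :: 'a set topology)"
proof -
  have "sigma_stone_space (dual_topology :: 'a set topology) \<longleftrightarrow>
      (\<forall>b :: nat \<Rightarrow> 'a. clopenin dual_topology (dual_topology closure_of (\<Union>n. stone (b n))))"
    unfolding sigma_stone_space_def all_clopenin_dual_seq_iff by (simp add: stone_space_dual)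
  also have "\<dots> \<longleftrightarrow> (\<forall>b :: nat \<Rightarrow> 'a. \<exists>s. isLub UNIV (range b) s)"
    by (simp add: clopenin_dual_iff closure_of_UN_stone_eq_iff)
  finally show ?thesis
    by (simp add: sigma_boolean_algebra_iff_seq)
qed

lemma rel_dia_UN_stone:
  "modal_algebra dia \<Longrightarrow>
    rel_dia dual_topology (dual_rel dia) (\<Union>n. stone (b n)) = (\<Union>n. stone (dia (b n)))"
  by (simp add: rel_dia_UN rel_dia_stone)

theorem sigma_modal_algebra_iff_sigma_modal_space:
  fixes dia :: "'a::boolean_algebra \<Rightarrow> 'a"
  assumes dia: "modal_algebra dia"
  shows "sigma_modal_algebra dia \<longleftrightarrow> sigma_modal_space dual_topology (dual_rel dia)"
proof
  assume alg: "sigma_modal_algebra dia"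
  show "sigma_modal_space dual_topology (dual_rel dia)"
    unfolding sigma_modal_space_def
  proof (intro conjI allI impI modal_space_dual[OF dia])
    show "sigma_stone_space (dual_topology :: 'a set topology)"
      using alg by (simp add: sigma_modal_algebra_def sigma_boolean_algebra_iff_sigma_stone_space)
  next
    fix a :: "nat \<Rightarrow> 'a set set"
    assume "\<forall>n. clopenin dual_topology (a n)"
    then obtain b where a: "a = (\<lambda>n. stone (b n))"
      by (rule clopenin_dual_seqE)
    obtain s where s: "isLub UNIV (range b) s"
      using alg unfolding sigma_modal_algebra_def sigma_boolean_algebra_iff_seq by blast
    then have "isLub UNIV (range (\<lambda>n. dia (b n))) (dia s)"
      using alg by (auto simp: sigma_modal_algebra_def)
    with s show "rel_dia dual_topology (dual_rel dia) (dual_topology closure_of (\<Union>n. a n)) =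
        dual_topology closure_of (rel_dia dual_topology (dual_rel dia) (\<Union>n. a n))"
      by (simp add: a rel_dia_UN_stone[OF dia] rel_dia_stone[OF dia]
          flip: closure_of_UN_stone_eq_iff)
  qed
next
  assume sp: "sigma_modal_space dual_topology (dual_rel dia)"
  show "sigma_modal_algebra dia"
    unfolding sigma_modal_algebra_def
  proof (intro conjI allI impI)
    show "sigma_boolean_algebra TYPE('a)"
      using sp by (simp add: sigma_modal_space_def sigma_boolean_algebra_iff_sigma_stone_space)
    show "dia bot = bot"
      using dia by (simp add: modal_algebra_def)
  next
    fix b :: "nat \<Rightarrow> 'a" and s assume "isLub UNIV (range b) s"
    then have "dual_topology closure_of (\<Union>n. stone (b n)) = stone s"
      by (simp add: closure_of_UN_stone_eq_iff)
    then have "stone (dia s) = rel_dia dual_topology (dual_rel dia)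
        (dual_topology closure_of (\<Union>n. stone (b n)))"
      by (simp add: rel_dia_stone[OF dia])
    also have "\<dots> = dual_topology closure_of (\<Union>n. stone (dia (b n)))"
      using sp unfolding sigma_modal_space_def all_clopenin_dual_seq_iff
      by (simp add: rel_dia_UN_stone[OF dia])
    finally show "isLub UNIV (range (\<lambda>n. dia (b n))) (dia s)"
      by (metis closure_of_UN_stone_eq_iff)
  qed
qed


section \<open>Null-sets and measurability\<close>

lemma interior_of_INT_stone_empty_iff:
  "dual_topology interior_of (\<Inter>n::nat. stone (b n)) = {} \<longleftrightarrow> isGlb UNIV (range b) bot"
proof
  assume int: "dual_topology interior_of (\<Inter>n. stone (b n)) = {}"
  have "t = bot" if "\<forall>n. t \<le> b n" for t
  proof -
    have "stone t \<subseteq> (\<Inter>n. stone (b n))"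
      using that by (simp add: le_INF_iff)
    then show ?thesis
      using int openin_stone[of t] unfolding interior_of_eq_empty
      by (metis stone_eq_empty_iff)
  qed
  then show "isGlb UNIV (range b) bot"
    by (simp add: isGlb_UNIV_iff bot_unique)
next
  assume glb: "isGlb UNIV (range b) bot"
  show "dual_topology interior_of (\<Inter>n. stone (b n)) = {}"
    unfolding interior_of_eq_empty
  proof (intro allI impI, rule ccontr)
    fix V assume V: "openin dual_topology V \<and> V \<subseteq> (\<Inter>n. stone (b n))" "V \<noteq> {}"
    then obtain u c where c: "u \<in> stone c" "stone c \<subseteq> V"
      by (metis ex_in_conv openin_dual_imp_stone_base)
    then have "stone c \<subseteq> stone (b n)" for n
      using V(1) by blast
    then have "c = bot"
      using glb by (simp add: isGlb_UNIV_iff bot_unique)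
    then show False
      using c(1) by simp
  qed
qed

lemma closedin_basic_null_set: "basic_null_set T N \<Longrightarrow> closedin T N"
  by (auto simp: basic_null_set_def clopenin_def)

lemma interior_of_basic_null_set: "basic_null_set T N \<Longrightarrow> T interior_of N = {}"
  by (auto simp: basic_null_set_def)

primrec running_inf :: "(nat \<Rightarrow> 'a::semilattice_inf) \<Rightarrow> nat \<Rightarrow> 'a" where
  "running_inf b 0 = b 0"
| "running_inf b (Suc n) = inf (running_inf b n) (b (Suc n))"

lemma decseq_running_inf: "decseq (running_inf b)"
  by (rule decseq_SucI) simp

lemma INT_stone_running_inf: "(\<Inter>n. stone (running_inf b n)) = (\<Inter>n. stone (b n))"
proof
  have "running_inf b n \<le> b n" for n
    by (cases n) auto
  then show "(\<Inter>n. stone (running_inf b n)) \<subseteq> (\<Inter>n. stone (b n))"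
    by (intro INF_mono) auto
next
  have "(\<Inter>n. stone (b n)) \<subseteq> stone (running_inf b m)" for m
    by (induction m) (auto simp: stone_inf)
  then show "(\<Inter>n. stone (b n)) \<subseteq> (\<Inter>n. stone (running_inf b n))"
    by blast
qed

text \<open>Replacing a sequence by its running meets changes neither the intersection nor its interior,
  so basic null-sets are exactly the intersections of the descending chains with meet \<open>bot\<close> that
  occur in the definition of measurability.\<close>

lemma basic_null_set_dual_iff:
  "basic_null_set dual_topology N \<longleftrightarrow>
    (\<exists>b. decseq b \<and> isGlb UNIV (range b) bot \<and> N = (\<Inter>n. stone (b n)))"
proof
  assume "basic_null_set dual_topology N"
  then obtain a where "\<forall>n. clopenin dual_topology (a n)" and
    N: "N = (\<Inter>n::nat. a n)" "dual_topology interior_of (\<Inter>n. a n) = {}"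
    unfolding basic_null_set_def by blast
  then obtain b where "a = (\<lambda>n. stone (b n))"
    using clopenin_dual_seqE by blast
  then have "N = (\<Inter>n. stone (running_inf b n))" "isGlb UNIV (range (running_inf b)) bot"
    using N by (simp_all add: INT_stone_running_inf flip: interior_of_INT_stone_empty_iff)
  then show "\<exists>b. decseq b \<and> isGlb UNIV (range b) bot \<and> N = (\<Inter>n. stone (b n))"
    using decseq_running_inf by blast
next
  assume "\<exists>b. decseq b \<and> isGlb UNIV (range b) bot \<and> N = (\<Inter>n. stone (b n))"
  then show "basic_null_set dual_topology N"
    unfolding basic_null_set_def using clopenin_stone interior_of_INT_stone_empty_iff by metis
qed

text \<open>Basic null-sets are closed and nowhere dense, so this is the Baire category theorem.\<close>

lemma interior_of_baire_null_set:
  assumes T: "compact_space T" "Hausdorff_space T" and S: "baire_null_set T S"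
  shows "T interior_of S = {}"
proof -
  obtain \<N> where \<N>: "countable \<N>" "\<And>N. N \<in> \<N> \<Longrightarrow> basic_null_set T N" "S \<subseteq> \<Union>\<N>"
    using S by (auto simp: baire_null_set_def)
  have "T interior_of \<Union>\<N> = {}"
    using T \<N>(1,2)
    by (intro Baire_category_alt)
      (auto simp: compact_imp_locally_compact_space compact_Hausdorff_imp_regular_space
        closedin_basic_null_set interior_of_basic_null_set)
  then show ?thesis
    using interior_of_mono[OF \<N>(3), of T] by blast
qed

lemma baire_null_set_basic: "basic_null_set T N \<Longrightarrow> baire_null_set T N"
  unfolding baire_null_set_def
  using closedin_subset[OF closedin_basic_null_set] by (blast intro: exI[of _ "{N}"])

text \<open>A diamond preserves unions, so only its effect on the members of a countable cover by basic
  null-sets matters.\<close>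

lemma baire_null_set_rel_dia:
  assumes basic: "\<And>N. basic_null_set T N \<Longrightarrow> basic_null_set T (rel_dia T R N)"
    and S: "baire_null_set T S"
  shows "baire_null_set T (rel_dia T R S)"
proof -
  obtain \<N> where \<N>: "countable \<N>" "\<And>N. N \<in> \<N> \<Longrightarrow> basic_null_set T N" "S \<subseteq> \<Union>\<N>"
    using S by (auto simp: baire_null_set_def)
  have "rel_dia T R S \<subseteq> \<Union>(rel_dia T R ` \<N>)"
    using \<N>(3) by (fastforce simp: rel_dia_def)
  moreover have "countable (rel_dia T R ` \<N>)" "\<forall>M\<in>rel_dia T R ` \<N>. basic_null_set T M"
    using \<N>(1,2) basic by auto
  moreover have "rel_dia T R S \<subseteq> topspace T"
    by (auto simp: rel_dia_def)
  ultimately show ?thesis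
    unfolding baire_null_set_def by blast
qed

theorem measurable_sigma_modal_algebra_iff_space:
  fixes dia :: "'a::boolean_algebra \<Rightarrow> 'a"
  assumes dia: "modal_algebra dia"
  shows "measurable_sigma_modal_algebra dia \<longleftrightarrow>
    measurable_sigma_modal_space dual_topology (dual_rel dia)"
proof
  assume alg: "measurable_sigma_modal_algebra dia"
  have "basic_null_set dual_topology (rel_dia dual_topology (dual_rel dia) N)"
    if N: "basic_null_set dual_topology N" for N
  proof -
    obtain b where b: "decseq b" "isGlb UNIV (range b) bot" "N = (\<Inter>n. stone (b n))"
      using N unfolding basic_null_set_dual_iff by blast
    have "decseq (\<lambda>n. dia (b n))"
      using b(1) modal_algebra_mono[OF dia] by (auto simp: decseq_def)
    moreover have "isGlb UNIV (range (\<lambda>n. dia (b n))) bot"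
      using alg b(1,2) by (auto simp: measurable_sigma_modal_algebra_def)
    ultimately show ?thesis
      unfolding basic_null_set_dual_iff b(3) rel_dia_INT_stone[OF dia b(1)] by blast
  qed
  then show "measurable_sigma_modal_space dual_topology (dual_rel dia)"
    using alg baire_null_set_rel_dia sigma_modal_algebra_iff_sigma_modal_space[OF dia]
    unfolding measurable_sigma_modal_space_def measurable_sigma_modal_algebra_def by blast
next
  assume sp: "measurable_sigma_modal_space dual_topology (dual_rel dia)"
  have "isGlb UNIV (range (\<lambda>n. dia (b n))) bot"
    if b: "decseq b" "isGlb UNIV (range b) bot" for b :: "nat \<Rightarrow> 'a"
  proof -
    have "basic_null_set dual_topology (\<Inter>n. stone (b n))"
      using b unfolding basic_null_set_dual_iff by blast
    then have "baire_null_set dual_topology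
        (rel_dia dual_topology (dual_rel dia) (\<Inter>n. stone (b n)))"
      using sp baire_null_set_basic unfolding measurable_sigma_modal_space_def by blast
    then have "dual_topology interior_of (\<Inter>n. stone (dia (b n))) = {}"
      unfolding rel_dia_INT_stone[OF dia b(1)]
      by (rule interior_of_baire_null_set[OF compact_space_dual Hausdorff_space_dual])
    then show ?thesis
      by (simp add: interior_of_INT_stone_empty_iff)
  qed
  then show "measurable_sigma_modal_algebra dia"
    using sp sigma_modal_algebra_iff_sigma_modal_space[OF dia]
    unfolding measurable_sigma_modal_space_def measurable_sigma_modal_algebra_def by blast
qed

theorem theorem7p3:
  fixes dia :: "'a::boolean_algebra \<Rightarrow> 'a"
  assumes "modal_algebra dia"
  shows "(sigma_modal_algebra dia \<longleftrightarrow>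
            sigma_modal_space (dual_topology :: 'a set topology) (dual_rel dia)) \<and>
         (measurable_sigma_modal_algebra dia \<longleftrightarrow>
            measurable_sigma_modal_space (dual_topology :: 'a set topology) (dual_rel dia))"
  using assms sigma_modal_algebra_iff_sigma_modal_space measurable_sigma_modal_algebra_iff_space
  by blast

end
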